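(* Let $J$ be the semi-infinite real tridiagonal matrix with entries $J_{n,n}=m_n$, $J_{n,n+1}=1$ for $n\in\mathbb N_0$ and $J_{n,n-1}=l_n>0$ for $n\in\mathbb N$ (all other entries zero), and assume that $J$ is bounded. Let $b$ be the supremum of the absolute values of all negative eigenvalues of the truncations $J^{[N]}$, $N\in\mathbb N_0$. Then, for $s\ge b$, the matrix $J_s=J+sI$ is oscillatory and admits a positive bidiagonal factorization of the form $$J_s=\begin{bmatrix}1&0&0&\cdots\\ \alpha_2&1&0&\cdots\\ 0&\alpha_4&1&\cdots\\ \vdots&\ddots&\ddots&\ddots\end{bmatrix}\begin{bmatrix}\alpha_1&1&0&\cdots\\0&\alpha_3&1&\cdots\\0&0&\alpha_5&\ddots\\ \vdots&&\ddots&\ddots\end{bmatrix}$$ with $\alpha_n>0$ for all $n\in\mathbb N$.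
   Context: $\mathbb N=\{1,2,\dots\}$, $\mathbb N_0=\{0,1,\dots\}$; $J^{[N]}=(J_{i,j})_{0\le i,j\le N}$; all eigenvalues of $J^{[N]}$ are real. Bounded means that $J$ defines a bounded operator (equivalently its entries are uniformly bounded). If no truncation has a negative eigenvalue, $b=0$. A finite square matrix is oscillatory if it is totally nonnegative (all minors nonnegative), irreducible and nonsingular; a semi-infinite matrix is called oscillatory if all its leading principal submatrices are. In the factorization, the first factor is lower bidiagonal with unit diagonal and subdiagonal $\alpha_2,\alpha_4,\alpha_6,\dots$; the second factor is upper bidiagonal with diagonal $\alpha_1,\alpha_3,\alpha_5,\dots$ and superdiagonal entries equal to $1$. *)

theory Defs
  imports
    Complex_Main
    "Jordan_Normal_Form.Char_Poly"
    "Jordan_Normal_Form.DL_Submatrix"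
begin

type_synonym inf_mat = "nat \<Rightarrow> nat \<Rightarrow> real"

text \<open>Rows and columns of semi-infinite matrices are numbered from \<open>0\<close>. The values \<open>l 0\<close> here
  and \<open>\<alpha> 0\<close> below are never used.\<close>

definition jacobi :: "(nat \<Rightarrow> real) \<Rightarrow> (nat \<Rightarrow> real) \<Rightarrow> inf_mat" where
  "jacobi m l i j =
     (if j = i then m i else if j = i + 1 then 1 else if i = j + 1 then l i else 0)"

definition shifted :: "inf_mat \<Rightarrow> real \<Rightarrow> inf_mat" where
  "shifted A s i j = A i j + (if i = j then s else 0)"

definition truncation :: "inf_mat \<Rightarrow> nat \<Rightarrow> real mat" where
  "truncation A N = mat (N + 1) (N + 1) (\<lambda>(i, j). A i j)"

definition ell2 :: "(nat \<Rightarrow> real) \<Rightarrow> bool" where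
  "ell2 x \<longleftrightarrow> summable (\<lambda>n. (x n)\<^sup>2)"

definition ell2_norm :: "(nat \<Rightarrow> real) \<Rightarrow> real" where
  "ell2_norm x = sqrt (\<Sum>n. (x n)\<^sup>2)"

definition inf_mat_apply :: "inf_mat \<Rightarrow> (nat \<Rightarrow> real) \<Rightarrow> nat \<Rightarrow> real" where
  "inf_mat_apply A x i = (\<Sum>j. A i j * x j)"

text \<open>\<open>A\<close> defines a bounded operator on real \<open>\<ell>\<^sup>2\<close>. For a tridiagonal matrix this says that the
  entries are uniformly bounded, see \<open>bounded_operator_jacobi_iff\<close>.\<close>

definition bounded_operator :: "inf_mat \<Rightarrow> bool" where
  "bounded_operator A \<longleftrightarrow>
     (\<exists>C. \<forall>x. ell2 x \<longrightarrow>
        (\<forall>i. summable (\<lambda>j. A i j * x j)) \<and>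
        ell2 (inf_mat_apply A x) \<and>
        ell2_norm (inf_mat_apply A x) \<le> C * ell2_norm x)"

text \<open>For a bounded Jacobi matrix the set \<open>E\<close> is bounded above, so \<open>Sup E\<close> is a genuine supremum
  whenever \<open>E\<close> is nonempty.\<close>

definition neg_eigenvalue_bound :: "inf_mat \<Rightarrow> real" where
  "neg_eigenvalue_bound A =
     (let E = {\<bar>x\<bar> | x N. eigenvalue (truncation A N) x \<and> x < 0}
      in if E = {} then 0 else Sup E)"

definition totally_nonnegative :: "real mat \<Rightarrow> bool" where
  "totally_nonnegative A \<longleftrightarrow>
     (\<forall>I J. I \<subseteq> {..<dim_row A} \<longrightarrow> J \<subseteq> {..<dim_col A} \<longrightarrow> card I = card J \<longrightarrow>
        0 \<le> det (submatrix A I J))"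

text \<open>A matrix is reducible if a simultaneous permutation of rows and columns brings it to block
  triangular form with two nonempty diagonal blocks; \<open>S\<close> is the index set of one of the blocks.\<close>

definition irreducible_mat :: "real mat \<Rightarrow> bool" where
  "irreducible_mat A \<longleftrightarrow>
     \<not> (\<exists>S. S \<noteq> {} \<and> S \<subset> {..<dim_row A} \<and>
          (\<forall>i\<in>S. \<forall>j\<in>{..<dim_row A} - S. A $$ (i, j) = 0))"

definition oscillatory_mat :: "real mat \<Rightarrow> bool" where
  "oscillatory_mat A \<longleftrightarrow>
     square_mat A \<and> totally_nonnegative A \<and> irreducible_mat A \<and> invertible_mat A"

definition oscillatory :: "inf_mat \<Rightarrow> bool" where
  "oscillatory A \<longleftrightarrow> (\<forall>N. oscillatory_mat (truncation A N))"

definition lower_bidiagonal :: "(nat \<Rightarrow> real) \<Rightarrow> inf_mat" where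
  "lower_bidiagonal \<alpha> i j = (if i = j then 1 else if i = j + 1 then \<alpha> (2 * i) else 0)"

definition upper_bidiagonal :: "(nat \<Rightarrow> real) \<Rightarrow> inf_mat" where
  "upper_bidiagonal \<alpha> i j = (if i = j then \<alpha> (2 * i + 1) else if j = i + 1 then 1 else 0)"

text \<open>The series below has finitely many nonzero terms whenever the rows of \<open>A\<close> are finitely
  supported, as for a bidiagonal \<open>A\<close>.\<close>

definition inf_mat_mult :: "inf_mat \<Rightarrow> inf_mat \<Rightarrow> inf_mat" where
  "inf_mat_mult A B i j = (\<Sum>k. A i k * B k j)"


lemma jacobi_row_sums:
  "(\<lambda>j. jacobi m l i j * x j) sums
     (m i * x i + x (Suc i) + (if i = 0 then 0 else l i * x (i - 1)))"
proof -
  have "(\<lambda>j. jacobi m l i j * x j) sums (\<Sum>j\<in>{i - 1, i, Suc i}. jacobi m l i j * x j)"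
    by (rule sums_finite) (auto simp: jacobi_def)
  moreover have "(\<Sum>j\<in>{i - 1, i, Suc i}. jacobi m l i j * x j) =
      m i * x i + x (Suc i) + (if i = 0 then 0 else l i * x (i - 1))"
    by (cases i) (auto simp: jacobi_def)
  ultimately show ?thesis by simp
qed

lemma bounded_operator_entry:
  assumes "bounded_operator A"
  shows "\<exists>C. \<forall>i j. \<bar>A i j\<bar> \<le> C"
proof -
  obtain C where C: "\<And>x. ell2 x \<Longrightarrow> ell2 (inf_mat_apply A x) \<and>
      ell2_norm (inf_mat_apply A x) \<le> C * ell2_norm x"
    using assms unfolding bounded_operator_def by blast
  have "\<bar>A i j\<bar> \<le> C" for i j
  proof -
    let ?e = "\<lambda>k. if k = j then 1 else 0 :: real"
    have e: "(\<lambda>k. (?e k)\<^sup>2) sums 1"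
      using sums_finite[of "{j}" "\<lambda>k. (?e k)\<^sup>2"] by auto
    have Ae: "inf_mat_apply A ?e = (\<lambda>i. A i j)"
    proof
      fix i
      show "inf_mat_apply A ?e i = A i j"
        using sums_finite[of "{j}" "\<lambda>k. A i k * ?e k"]
        by (auto simp: inf_mat_apply_def sums_iff)
    qed
    have "ell2 ?e" "ell2_norm ?e = 1"
      using e by (auto simp: ell2_def ell2_norm_def sums_iff)
    with C[of ?e] Ae have s: "summable (\<lambda>i. (A i j)\<^sup>2)" and
      n: "sqrt (\<Sum>i. (A i j)\<^sup>2) \<le> C"
      by (auto simp: ell2_def ell2_norm_def)
    have "(A i j)\<^sup>2 \<le> (\<Sum>i. (A i j)\<^sup>2)"
      using sum_le_suminf[OF s, of "{i}"] by simp
    then have "\<bar>A i j\<bar> \<le> sqrt (\<Sum>i. (A i j)\<^sup>2)"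
      using real_sqrt_le_mono by fastforce
    with n show ?thesis by simp
  qed
  then show ?thesis by blast
qed

lemma bounded_operator_jacobi_iff:
  "bounded_operator (jacobi m l) \<longleftrightarrow> (\<exists>C. \<forall>i j. \<bar>jacobi m l i j\<bar> \<le> C)"
proof
  assume "\<exists>C. \<forall>i j. \<bar>jacobi m l i j\<bar> \<le> C"
  then obtain C where C: "\<And>i j. \<bar>jacobi m l i j\<bar> \<le> C" by blast
  have C1: "1 \<le> C" using C[of 0 1] by (simp add: jacobi_def)
  have Cm: "\<bar>m i\<bar> \<le> C" for i using C[of i i] by (simp add: jacobi_def)
  have Cl: "\<bar>l (Suc i)\<bar> \<le> C" for i using C[of "Suc i" i] by (simp add: jacobi_def)
  have "ell2 (inf_mat_apply (jacobi m l) x) \<and>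
      ell2_norm (inf_mat_apply (jacobi m l) x) \<le> 3 * C * ell2_norm x" if x: "ell2 x" for x
  proof -
    define y where "y = inf_mat_apply (jacobi m l) x"
    define z where "z i = (if i = 0 then 0 else x (i - 1))" for i
    let ?g = "\<lambda>i. 3 * C\<^sup>2 * ((x i)\<^sup>2 + (x (Suc i))\<^sup>2 + (z i)\<^sup>2)"
    have le: "(y i)\<^sup>2 \<le> ?g i" for i
    proof -
      have y: "y i = m i * x i + x (Suc i) + (if i = 0 then 0 else l i * x (i - 1))"
        unfolding y_def inf_mat_apply_def by (rule sums_unique[OF jacobi_row_sums, symmetric])
      have 1: "\<bar>m i * x i\<bar> \<le> C * \<bar>x i\<bar>"
        using Cm[of i] by (simp add: abs_mult mult_right_mono)
      have 2: "\<bar>x (Suc i)\<bar> \<le> C * \<bar>x (Suc i)\<bar>"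
        using mult_right_mono[OF C1, of "\<bar>x (Suc i)\<bar>"] by simp
      have 3: "\<bar>if i = 0 then 0 else l i * x (i - 1)\<bar> \<le> C * \<bar>z i\<bar>"
        using Cl[of "i - 1"] by (cases i) (auto simp: z_def abs_mult mult_right_mono)
      have "\<bar>y i\<bar> \<le> C * (\<bar>x i\<bar> + \<bar>x (Suc i)\<bar> + \<bar>z i\<bar>)"
        unfolding y distrib_left using 1 2 3 by linarith
      then have "(y i)\<^sup>2 \<le> (C * (\<bar>x i\<bar> + \<bar>x (Suc i)\<bar> + \<bar>z i\<bar>))\<^sup>2"
        using power_mono[of "\<bar>y i\<bar>" _ 2] by simp
      also have "\<dots> = C\<^sup>2 * (\<bar>x i\<bar> + \<bar>x (Suc i)\<bar> + \<bar>z i\<bar>)\<^sup>2"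
        by (rule power_mult_distrib)
      also have "\<dots> \<le> C\<^sup>2 * (3 * (\<bar>x i\<bar>\<^sup>2 + \<bar>x (Suc i)\<bar>\<^sup>2 + \<bar>z i\<bar>\<^sup>2))"
      proof (rule mult_left_mono)
        have "(a + b + c)\<^sup>2 \<le> 3 * (a\<^sup>2 + b\<^sup>2 + c\<^sup>2)" for a b c :: real
          using zero_le_power2[of "a - b"] zero_le_power2[of "a - c"] zero_le_power2[of "b - c"]
          unfolding power2_eq_square by (simp add: algebra_simps)
        then show "(\<bar>x i\<bar> + \<bar>x (Suc i)\<bar> + \<bar>z i\<bar>)\<^sup>2 \<le> 3 * (\<bar>x i\<bar>\<^sup>2 + \<bar>x (Suc i)\<bar>\<^sup>2 + \<bar>z i\<bar>\<^sup>2)" .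
      qed simp
      also have "\<dots> = ?g i" by simp
      finally show ?thesis .
    qed
    define S where "S = (\<Sum>n. (x n)\<^sup>2)"
    have s1: "(\<lambda>i. (x i)\<^sup>2) sums S" using x by (simp add: ell2_def S_def summable_sums)
    have s2: "(\<lambda>i. (x (Suc i))\<^sup>2) sums (S - (x 0)\<^sup>2)"
      using s1 sums_Suc_iff[of "\<lambda>i. (x i)\<^sup>2" "S - (x 0)\<^sup>2"] by simp
    have s3: "(\<lambda>i. (z i)\<^sup>2) sums S"
      using s1 sums_Suc_iff[of "\<lambda>i. (z i)\<^sup>2" S] by (simp add: z_def)
    have sg: "?g sums (3 * C\<^sup>2 * (S + (S - (x 0)\<^sup>2) + S))"
      by (intro sums_mult sums_add s1 s2 s3)
    have sy: "summable (\<lambda>i. (y i)\<^sup>2)"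
      by (rule summable_comparison_test'[OF sums_summable[OF sg], of 0]) (use le in auto)
    have "(\<Sum>i. (y i)\<^sup>2) \<le> (\<Sum>i. ?g i)"
      by (rule suminf_le[OF le sy sums_summable[OF sg]])
    also have "\<dots> = 3 * C\<^sup>2 * (S + (S - (x 0)\<^sup>2) + S)"
      by (rule sums_unique[OF sg, symmetric])
    also have "\<dots> \<le> 3 * C\<^sup>2 * (3 * S)"
      by (rule mult_left_mono) auto
    also have "\<dots> = (3 * C)\<^sup>2 * S" by (simp add: power2_eq_square)
    finally have "sqrt (\<Sum>i. (y i)\<^sup>2) \<le> sqrt ((3 * C)\<^sup>2 * S)" by (rule real_sqrt_le_mono)
    also have "\<dots> = 3 * C * sqrt S" using C1 by (simp add: real_sqrt_mult)
    finally show ?thesis using sy unfolding y_def S_def ell2_def ell2_norm_def by simp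
  qed
  then show "bounded_operator (jacobi m l)"
    unfolding bounded_operator_def using sums_summable[OF jacobi_row_sums] by blast
qed (rule bounded_operator_entry)

end

theory Submission
  imports Defs
begin

text \<open>Let \<open>D n s\<close> be the leading principal minor of size \<open>n\<close> of \<open>J + s I\<close>, so that \<open>D 0 s = 1\<close>.
  Everything follows from \<open>D n s > 0\<close> for all \<open>n\<close> and all \<open>s \<ge> b\<close>.

  These numbers satisfy \<open>D (n + 2) s = (m (n + 1) + s) * D (n + 1) s - l (n + 1) * D n s\<close>. Since
  the entries of \<open>J\<close> are bounded, \<open>D n s\<close> is positive for all \<open>n\<close> once \<open>s\<close> is large; in particular
  the negative eigenvalues of the truncations are bounded, and \<open>b\<close> is a true upper bound of their
  absolute values. Were \<open>D (n + 1)\<close> the first leading minor to fail positivity on \<open>s \<ge> b\<close>, it would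
  have a zero \<open>t \<ge> b\<close>, where the recurrence gives \<open>D (n + 2) t = - l (n + 1) * D n t < 0\<close>. Hence
  \<open>D (n + 2)\<close> would have a zero \<open>t' > t \<ge> b\<close>, and \<open>- t'\<close> would be a negative eigenvalue of a
  truncation beyond the bound \<open>b\<close> (\<open>leading_minor_shifted_jacobi_pos\<close>).

  With positive leading minors, Gaussian elimination runs without pivoting and with positive
  pivots \<open>D (n + 1) / D n\<close> and multipliers \<open>l n * D (n - 1) / D n\<close>; this is the bidiagonal
  factorization, and \<open>\<alpha>\<close> lists multipliers and pivots alternately. The truncations are invertible
  because \<open>D n > 0\<close>, and irreducible because the off-diagonal entries do not vanish. Total
  nonnegativity is usually derived from the factorization by the Cauchy--Binet formula. Here it
  is proved by induction on the size of the minor, where the pivots serve as lower bounds for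
  quotients of consecutive minors (\<open>tridiagonal_minor_bounds\<close>).\<close>

section \<open>Expanding determinants along a sparse border\<close>

lemma det_sparse_last_column:
  fixes f :: "nat \<Rightarrow> nat \<Rightarrow> 'a :: comm_ring_1"
  assumes "\<And>i. i < k \<Longrightarrow> f i k = 0"
  shows "det (mat (Suc k) (Suc k) (\<lambda>(i, j). f i j)) = f k k * det (mat k k (\<lambda>(i, j). f i j))"
proof -
  let ?A = "mat (Suc k) (Suc k) (\<lambda>(i, j). f i j)"
  have "det ?A = (\<Sum>i<Suc k. ?A $$ (i, k) * cofactor ?A i k)"
    by (rule laplace_expansion_column) auto
  also have "\<dots> = f k k * cofactor ?A k k"
    using assms by simp
  also have "mat_delete ?A k k = mat k k (\<lambda>(i, j). f i j)"
    by (rule eq_matI) (auto simp: mat_delete_def)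
  then have "cofactor ?A k k = det (mat k k (\<lambda>(i, j). f i j))"
    by (simp add: cofactor_def)
  finally show ?thesis .
qed

lemma det_sparse_last_row:
  fixes f :: "nat \<Rightarrow> nat \<Rightarrow> 'a :: comm_ring_1"
  assumes "\<And>j. j < k \<Longrightarrow> f k j = 0"
  shows "det (mat (Suc k) (Suc k) (\<lambda>(i, j). f i j)) = f k k * det (mat k k (\<lambda>(i, j). f i j))"
proof -
  have tr: "det (mat n n (\<lambda>(i, j). f i j)) = det (mat n n (\<lambda>(i, j). f j i))" for n
  proof -
    have "transpose_mat (mat n n (\<lambda>(i, j). f i j)) = mat n n (\<lambda>(i, j). f j i)"
      by (rule eq_matI) auto
    then show ?thesis
      using det_transpose[of "mat n n (\<lambda>(i, j). f i j)" n] by simp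
  qed
  show ?thesis
    unfolding tr using assms by (rule det_sparse_last_column)
qed

text \<open>The three-term recurrence of continuants. Only the last row and the last column have to be
  sparse, so it applies to an arbitrary minor of a tridiagonal matrix whose last row index equals
  its last column index.\<close>

lemma det_continuant:
  fixes f :: "nat \<Rightarrow> nat \<Rightarrow> 'a :: comm_ring_1"
  assumes row: "\<And>j. j < k \<Longrightarrow> f (Suc k) j = 0"
    and col: "\<And>i. i < k \<Longrightarrow> f i (Suc k) = 0"
  shows "det (mat (Suc (Suc k)) (Suc (Suc k)) (\<lambda>(i, j). f i j)) =
    f (Suc k) (Suc k) * det (mat (Suc k) (Suc k) (\<lambda>(i, j). f i j))
    - f (Suc k) k * f k (Suc k) * det (mat k k (\<lambda>(i, j). f i j))"
proof -
  let ?A = "mat (Suc (Suc k)) (Suc (Suc k)) (\<lambda>(i, j). f i j)"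
  define g where "g i j = f i (if j < k then j else Suc j)" for i j
  have "det ?A = (\<Sum>j<Suc (Suc k). ?A $$ (Suc k, j) * cofactor ?A (Suc k) j)"
    by (rule laplace_expansion_row) auto
  also have "\<dots> = f (Suc k) k * cofactor ?A (Suc k) k
      + f (Suc k) (Suc k) * cofactor ?A (Suc k) (Suc k)"
    using row by simp
  also have "mat_delete ?A (Suc k) (Suc k) = mat (Suc k) (Suc k) (\<lambda>(i, j). f i j)"
    by (rule eq_matI) (auto simp: mat_delete_def)
  then have "cofactor ?A (Suc k) (Suc k) = det (mat (Suc k) (Suc k) (\<lambda>(i, j). f i j))"
    by (simp add: cofactor_def)
  also have "mat_delete ?A (Suc k) k = mat (Suc k) (Suc k) (\<lambda>(i, j). g i j)"
    by (rule eq_matI) (auto simp: mat_delete_def g_def)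
  then have "cofactor ?A (Suc k) k = - det (mat (Suc k) (Suc k) (\<lambda>(i, j). g i j))"
    by (simp add: cofactor_def)
  also have "det (mat (Suc k) (Suc k) (\<lambda>(i, j). g i j)) =
      g k k * det (mat k k (\<lambda>(i, j). g i j))"
    by (rule det_sparse_last_column) (simp add: g_def col)
  also have "mat k k (\<lambda>(i, j). g i j) = mat k k (\<lambda>(i, j). f i j)"
    by (rule eq_matI) (auto simp: g_def)
  finally show ?thesis
    by (simp add: g_def algebra_simps)
qed

section \<open>Minors of tridiagonal matrices\<close>

definition tridiagonal :: "inf_mat \<Rightarrow> bool" where
  "tridiagonal A \<longleftrightarrow> (\<forall>i j. Suc i < j \<or> Suc j < i \<longrightarrow> A i j = 0)"

definition minor :: "inf_mat \<Rightarrow> (nat \<Rightarrow> nat) \<Rightarrow> (nat \<Rightarrow> nat) \<Rightarrow> nat \<Rightarrow> real" where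
  "minor A r c k = det (mat k k (\<lambda>(i, j). A (r i) (c j)))"

abbreviation leading_minor :: "inf_mat \<Rightarrow> nat \<Rightarrow> real" where
  "leading_minor A n \<equiv> minor A (\<lambda>i. i) (\<lambda>i. i) n"

lemma minor_0 [simp]: "minor A r c 0 = 1"
  by (simp add: minor_def)

lemma minor_1: "minor A r c (Suc 0) = A (r 0) (c 0)"
  unfolding minor_def by (subst det_single) auto

lemma det_truncation: "det (truncation A N) = leading_minor A (Suc N)"
  by (simp add: minor_def truncation_def)

lemma leading_minor_tridiagonal:
  assumes "tridiagonal A"
  shows "leading_minor A (Suc (Suc n)) = A (Suc n) (Suc n) * leading_minor A (Suc n)
    - A (Suc n) n * A n (Suc n) * leading_minor A n"
  unfolding minor_def by (rule det_continuant) (use assms in \<open>auto simp: tridiagonal_def\<close>)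

text \<open>When \<open>w 0 = 0\<close>, \<open>u\<close> is the sequence of pivots of \<open>A\<close>, and \<open>u\<close> and \<open>w\<close> are the data of an
  \<open>LU\<close> factorization with bidiagonal factors. Expanding along the last row and column, a minor of size \<open>k + 1\<close> either
  splits off a single nonnegative entry, or its last row and column have the same index \<open>n\<close>. In
  the second case the continuant recurrence has a negative term, and nonnegativity alone does not
  survive the induction; the bound by \<open>u n\<close> times the minor of size \<open>k\<close> does, because it says that
  the pivot at \<open>n\<close>, which is \<open>u n\<close> when all earlier rows and columns are selected, can only grow
  when some of them are skipped.\<close>

lemma tridiagonal_minor_bounds:
  assumes tri: "tridiagonal A"
    and super: "\<And>n. A n (Suc n) \<ge> 0" and sub: "\<And>n. A (Suc n) n \<ge> 0"
    and u: "\<And>n. u n \<ge> 0" and w: "\<And>n. w n \<ge> 0"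
    and diag: "\<And>n. A n n = w n + u n"
    and off_diag: "\<And>n. w (Suc n) * u n = A (Suc n) n * A n (Suc n)"
    and r: "\<And>i j. i < j \<Longrightarrow> j < k \<Longrightarrow> r i < r j"
    and c: "\<And>i j. i < j \<Longrightarrow> j < k \<Longrightarrow> c i < c j"
  shows "minor A r c k \<ge> 0 \<and>
    (\<forall>k'. k = Suc k' \<and> r k' = c k' \<longrightarrow> minor A r c k \<ge> u (r k') * minor A r c k')"
  using r c
proof (induction k)
  case 0
  then show ?case by simp
next
  case (Suc k)
  have nonneg: "A i j \<ge> 0" for i j
  proof -
    consider "Suc i < j \<or> Suc j < i" | "j = Suc i" | "i = Suc j" | "i = j" by linarith
    then show ?thesis
      using tri super sub u[of i] w[of i] diag[of i] by cases (auto simp: tridiagonal_def)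
  qed
  have IH: "minor A r c k \<ge> 0"
    "\<And>k'. k = Suc k' \<Longrightarrow> r k' = c k' \<Longrightarrow> minor A r c k \<ge> u (r k') * minor A r c k'"
    using Suc by auto
  have zero: "A i j = 0" if "Suc i < j \<or> Suc j < i" for i j
    using tri that by (auto simp: tridiagonal_def)
  consider "r k < c k" | "c k < r k" | "r k = c k" by linarith
  then show ?case
  proof cases
    case 1
    have "A (r i) (c k) = 0" if "i < k" for i
      using Suc.prems(1)[OF that] 1 by (intro zero) linarith
    then have "minor A r c (Suc k) = A (r k) (c k) * minor A r c k"
      unfolding minor_def by (rule det_sparse_last_column)
    then show ?thesis using 1 nonneg IH(1) by simp
  next
    case 2
    have "A (r k) (c j) = 0" if "j < k" for j
      using Suc.prems(2)[OF that] 2 by (intro zero) linarith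
    then have "minor A r c (Suc k) = A (r k) (c k) * minor A r c k"
      unfolding minor_def by (rule det_sparse_last_row)
    then show ?thesis using 2 nonneg IH(1) by simp
  next
    case 3
    have "minor A r c (Suc k) \<ge> u (r k) * minor A r c k"
    proof (cases k)
      case 0
      then show ?thesis using 3 w by (simp add: minor_1 diag)
    next
      case (Suc p)
      have rp: "r p < r k" "c p < c k"
        using Suc.prems Suc by auto
      have rows: "r i < r p" "c i < c p" if "i < p" for i
        using Suc.prems Suc that by auto
      have exp: "minor A r c (Suc k) = A (r k) (c k) * minor A r c k
          - A (r k) (c p) * A (r p) (c k) * minor A r c p"
        unfolding minor_def Suc
        by (rule det_continuant; rule zero) (use rows rp 3 Suc in force)+
      have "A (r k) (c p) * A (r p) (c k) * minor A r c p \<le> w (r k) * minor A r c k"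
      proof (cases "r k = Suc (r p) \<and> c k = Suc (c p)")
        case True
        then have eq: "c p = r p" using 3 by simp
        have "u (r p) * minor A r c p \<le> minor A r c k"
          using IH(2)[OF Suc] eq by simp
        then have "w (Suc (r p)) * (u (r p) * minor A r c p) \<le> w (Suc (r p)) * minor A r c k"
          by (rule mult_left_mono) (rule w)
        then show ?thesis
          using True eq off_diag[of "r p"] 3 by (simp flip: mult.assoc)
      next
        case False
        then have "A (r k) (c p) = 0 \<or> A (r p) (c k) = 0"
          using rp 3 zero[of "r k" "c p"] zero[of "r p" "c k"] by linarith
        then show ?thesis using w IH(1) by auto
      qed
      then show ?thesis
        unfolding exp 3[symmetric] diag by (simp add: algebra_simps)
    qed
    moreover from this have "minor A r c (Suc k) \<ge> 0"
      using mult_nonneg_nonneg[OF u[of "r k"] IH(1)] by linarith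
    ultimately show ?thesis using 3 by simp
  qed
qed

lemma totally_nonnegative_truncation:
  assumes "tridiagonal A"
    and "\<And>n. A n (Suc n) \<ge> 0" and "\<And>n. A (Suc n) n \<ge> 0"
    and "\<And>n. u n \<ge> 0" and "\<And>n. w n \<ge> 0"
    and "\<And>n. A n n = w n + u n"
    and "\<And>n. w (Suc n) * u n = A (Suc n) n * A n (Suc n)"
  shows "totally_nonnegative (truncation A N)"
  unfolding totally_nonnegative_def
proof (intro allI impI)
  fix I J
  let ?T = "truncation A N"
  assume I: "I \<subseteq> {..<dim_row ?T}" and J: "J \<subseteq> {..<dim_col ?T}" and IJ: "card I = card J"
  have dims: "dim_row ?T = Suc N" "dim_col ?T = Suc N"
    by (simp_all add: truncation_def)
  have sets: "{i. i < Suc N \<and> i \<in> I} = I" "{j. j < Suc N \<and> j \<in> J} = J"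
    using I J dims by auto
  have "submatrix ?T I J = mat (card I) (card I) (\<lambda>(i, j). A (pick I i) (pick J j))"
  proof (rule eq_matI)
    fix i j
    assume "i < dim_row (mat (card I) (card I) (\<lambda>(i, j). A (pick I i) (pick J j)))"
      "j < dim_col (mat (card I) (card I) (\<lambda>(i, j). A (pick I i) (pick J j)))"
    then have ij: "i < card I" "j < card J" using IJ by auto
    then have "pick I i < Suc N" "pick J j < Suc N"
      using pick_in_set_le[OF ij(1)] pick_in_set_le[OF ij(2)] I J dims by auto
    then show "submatrix ?T I J $$ (i, j) =
        mat (card I) (card I) (\<lambda>(i, j). A (pick I i) (pick J j)) $$ (i, j)"
      using ij IJ dims sets by (simp add: submatrix_def truncation_def)
  qed (use dims sets IJ in \<open>auto simp: dim_submatrix\<close>)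
  then have "det (submatrix ?T I J) = minor A (pick I) (pick J) (card I)"
    by (simp add: minor_def)
  moreover have "minor A (pick I) (pick J) (card I) \<ge> 0"
    by (rule tridiagonal_minor_bounds[THEN conjunct1, OF assms])
      (use pick_mono_le IJ in auto)
  ultimately show "0 \<le> det (submatrix ?T I J)"
    by simp
qed

text \<open>The directed graph of a tridiagonal matrix with nonzero off-diagonal entries is a path
  traversed in both directions, hence strongly connected: a proper nonempty index set has an
  element next to a non-element.\<close>

lemma irreducible_truncation:
  assumes "\<And>n. A n (Suc n) \<noteq> 0" and "\<And>n. A (Suc n) n \<noteq> 0"
  shows "irreducible_mat (truncation A N)"
  unfolding irreducible_mat_def
proof
  let ?T = "truncation A N"
  assume "\<exists>S. S \<noteq> {} \<and> S \<subset> {..<dim_row ?T} \<and>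
      (\<forall>i\<in>S. \<forall>j\<in>{..<dim_row ?T} - S. ?T $$ (i, j) = 0)"
  moreover have "dim_row ?T = Suc N" by (simp add: truncation_def)
  ultimately obtain S where S: "S \<noteq> {}" "S \<subset> {..<Suc N}"
    and zero: "\<And>i j. i \<in> S \<Longrightarrow> j < Suc N \<Longrightarrow> j \<notin> S \<Longrightarrow> ?T $$ (i, j) = 0"
    by auto
  have step: "n \<in> S \<longleftrightarrow> Suc n \<in> S" if "Suc n < Suc N" for n
    using zero[of n "Suc n"] zero[of "Suc n" n] that assms[of n] by (auto simp: truncation_def)
  have all: "n < Suc N \<Longrightarrow> n \<in> S \<longleftrightarrow> 0 \<in> S" for n
    by (induction n) (use step in auto)
  obtain i where "i \<in> S" using S by auto
  then have "0 \<in> S" using all[of i] S(2) by blast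
  then have "{..<Suc N} \<subseteq> S" using all by blast
  with S(2) show False by blast
qed

lemma invertible_mat_if_det_nonzero:
  fixes A :: "'a :: field mat"
  assumes "A \<in> carrier_mat n n" and "det A \<noteq> 0"
  shows "invertible_mat A"
proof -
  obtain B where "B \<in> carrier_mat n n" "B * A = 1\<^sub>m n" "A * B = 1\<^sub>m n"
    using det_non_zero_imp_unit[OF assms, of "()"] by (auto simp: Units_def ring_mat_def)
  then show ?thesis
    using assms(1) unfolding invertible_mat_def inverts_mat_def by auto
qed

section \<open>Leading minors of the shifted Jacobi matrix\<close>

lemma tridiagonal_shifted_jacobi: "tridiagonal (shifted (jacobi m l) s)"
  by (auto simp: tridiagonal_def shifted_def jacobi_def)

lemma leading_minor_shifted_jacobi_1:
  "leading_minor (shifted (jacobi m l) s) (Suc 0) = m 0 + s"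
  by (simp add: minor_1 shifted_def jacobi_def)

lemma leading_minor_shifted_jacobi_rec:
  "leading_minor (shifted (jacobi m l) s) (Suc (Suc n)) =
    (m (Suc n) + s) * leading_minor (shifted (jacobi m l) s) (Suc n)
    - l (Suc n) * leading_minor (shifted (jacobi m l) s) n"
  by (subst leading_minor_tridiagonal[OF tridiagonal_shifted_jacobi])
    (simp add: shifted_def jacobi_def)

lemma continuous_leading_minor_shifted_jacobi:
  "continuous_on UNIV (\<lambda>s. leading_minor (shifted (jacobi m l) s) n)"
proof (induction n rule: induct_nat_012)
  case 1
  then show ?case
    unfolding leading_minor_shifted_jacobi_1 by (intro continuous_intros)
next
  case (ge2 n)
  then show ?case
    unfolding leading_minor_shifted_jacobi_rec by (intro continuous_intros) auto
qed simp

text \<open>For large shifts the matrix is diagonally dominant. The induction needs that the leading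
  minors then do not decrease with the size: this lets the diagonal term absorb the negative term
  of the recurrence.\<close>

lemma leading_minor_shifted_jacobi_pos_large:
  assumes m: "\<And>n. \<bar>m n\<bar> \<le> C" and l: "\<And>n. \<bar>l (Suc n)\<bar> \<le> C" and s: "s \<ge> 2 * C + 1"
  shows "leading_minor (shifted (jacobi m l) s) n > 0"
proof -
  let ?D = "leading_minor (shifted (jacobi m l) s)"
  have C: "C \<ge> 0" using m[of 0] by linarith
  have "?D n > 0 \<and> ?D n \<le> ?D (Suc n)"
  proof (induction n)
    case 0
    then show ?case
      using m[of 0] s C by (simp add: leading_minor_shifted_jacobi_1)
  next
    case (Suc n)
    have "m (Suc n) + s \<ge> C + 1" using m[of "Suc n"] s by linarith
    then have 1: "(m (Suc n) + s) * ?D (Suc n) \<ge> (C + 1) * ?D (Suc n)"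
      using Suc by (intro mult_right_mono) auto
    have 2: "l (Suc n) * ?D n \<le> C * ?D (Suc n)"
      using Suc l[of n] C by (intro mult_mono) auto
    show ?case
      using 1 2 Suc unfolding leading_minor_shifted_jacobi_rec by (simp add: algebra_simps)
  qed
  then show ?thesis by simp
qed

lemma eigenvalue_truncation_iff:
  "eigenvalue (truncation A N) (- t) \<longleftrightarrow> leading_minor (shifted A t) (Suc N) = 0"
proof -
  have c: "truncation A N \<in> carrier_mat (Suc N) (Suc N)"
    by (simp add: truncation_def)
  have "char_matrix (truncation A N) (- t) = truncation (shifted A t) N"
    by (rule eq_matI) (auto simp: char_matrix_def truncation_def shifted_def)
  then show ?thesis
    using eigenvalue_det[OF c, of "- t"] by (simp add: det_truncation)
qed

text \<open>A real supremum is an upper bound only if the set is bounded above, hence the bound on the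
  entries.\<close>

lemma
  assumes m: "\<And>n. \<bar>m n\<bar> \<le> C" and l: "\<And>n. \<bar>l (Suc n)\<bar> \<le> C"
  shows neg_eigenvalue_bound_nonneg: "neg_eigenvalue_bound (jacobi m l) \<ge> 0"
    and neg_eigenvalue_bound_upper:
      "t > 0 \<Longrightarrow> eigenvalue (truncation (jacobi m l) N) (- t) \<Longrightarrow>
        t \<le> neg_eigenvalue_bound (jacobi m l)"
proof -
  define E where "E = {\<bar>x\<bar> | x N. eigenvalue (truncation (jacobi m l) N) x \<and> x < 0}"
  have b: "neg_eigenvalue_bound (jacobi m l) = (if E = {} then 0 else Sup E)"
    unfolding neg_eigenvalue_bound_def E_def Let_def by (rule refl)
  have "x \<le> 2 * C + 1" if "x \<in> E" for x
  proof -
    from that obtain N where "eigenvalue (truncation (jacobi m l) N) (- x)"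
      by (auto simp: E_def)
    then show ?thesis
      using leading_minor_shifted_jacobi_pos_large[of m C l x "Suc N"] m l
      by (fastforce simp: eigenvalue_truncation_iff)
  qed
  then have bdd: "bdd_above E" by (auto simp: bdd_above_def)
  show "neg_eigenvalue_bound (jacobi m l) \<ge> 0"
  proof (cases "E = {}")
    case False
    then obtain x where x: "x \<in> E" by blast
    then have "0 \<le> x" by (auto simp: E_def)
    also have "x \<le> Sup E" using x bdd by (rule cSup_upper)
    finally show ?thesis using False by (simp add: b)
  qed (simp add: b)
  assume "t > 0" "eigenvalue (truncation (jacobi m l) N) (- t)"
  then have "t \<in> E" by (force simp: E_def)
  then show "t \<le> neg_eigenvalue_bound (jacobi m l)"
    unfolding b using bdd by (auto intro: cSup_upper)
qed

text \<open>A qualitative form of interlacing suffices. If \<open>n\<close> is the first size for which the leading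
  minor vanishes at some shift \<open>t \<ge> b\<close>, then the recurrence makes the leading minor of size
  \<open>n + 1\<close> negative at \<open>t\<close>; being positive for large shifts, it has a zero \<open>t' > t\<close>. But then \<open>- t'\<close>
  is a negative eigenvalue of a truncation with absolute value larger than \<open>b\<close>. The strict
  inequality is what makes the closed range \<open>s \<ge> b\<close> admissible.\<close>

lemma leading_minor_shifted_jacobi_pos:
  assumes l_pos: "\<And>n. l (Suc n) > 0"
    and m: "\<And>n. \<bar>m n\<bar> \<le> C" and l: "\<And>n. \<bar>l (Suc n)\<bar> \<le> C"
    and s: "s \<ge> neg_eigenvalue_bound (jacobi m l)"
  shows "leading_minor (shifted (jacobi m l) s) n > 0"
  using s
proof (induction n arbitrary: s rule: less_induct)
  case (less n)
  let ?D = "\<lambda>n s. leading_minor (shifted (jacobi m l) s) n"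
  let ?b = "neg_eigenvalue_bound (jacobi m l)"
  have b: "?b \<ge> 0"
    using m l by (rule neg_eigenvalue_bound_nonneg)
  have root: "\<exists>t'\<ge>t. ?D k t' = 0" if "?D k t \<le> 0" for k t
  proof -
    define T where "T = max t (2 * C + 1)"
    have "0 \<le> ?D k T"
      using leading_minor_shifted_jacobi_pos_large[of m C l T k] m l
      by (simp add: T_def less_imp_le)
    moreover have "t \<le> T" by (simp add: T_def)
    moreover have "continuous_on {t..T} (?D k)"
      using continuous_leading_minor_shifted_jacobi by (rule continuous_on_subset) simp
    ultimately show ?thesis
      using IVT'[of "?D k" t 0 T] that by blast
  qed
  show ?case
  proof (rule ccontr)
    assume "\<not> ?D n s > 0"
    then obtain k where k: "n = Suc k"
      by (cases n) auto
    from \<open>\<not> ?D n s > 0\<close> obtain t where t: "t \<ge> s" "?D n t = 0"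
      using root[where k = n and t = s] by auto
    have "?D k t > 0"
      using less k t by auto
    then have neg: "?D (Suc n) t < 0"
      using l_pos[of k] t unfolding k leading_minor_shifted_jacobi_rec by simp
    then obtain t' where t': "t' \<ge> t" "?D (Suc n) t' = 0"
      using root[where k = "Suc n" and t = t] by auto
    have "t' \<noteq> t" using neg t'(2) by auto
    with t' t less.prems have "t' > ?b" by simp
    moreover have "t' \<le> ?b"
    proof (rule neg_eigenvalue_bound_upper[of m C l t' n])
      show "eigenvalue (truncation (jacobi m l) n) (- t')"
        using t' by (simp add: eigenvalue_truncation_iff)
    qed (use m l b \<open>t' > ?b\<close> in auto)
    ultimately show False by simp
  qed
qed

section \<open>Bidiagonal factorization\<close>

lemma bidiagonal_product:
  "inf_mat_mult (lower_bidiagonal \<alpha>) (upper_bidiagonal \<alpha>) i j =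
    upper_bidiagonal \<alpha> i j + (if i = 0 then 0 else \<alpha> (2 * i) * upper_bidiagonal \<alpha> (i - 1) j)"
proof -
  have "inf_mat_mult (lower_bidiagonal \<alpha>) (upper_bidiagonal \<alpha>) i j =
      (\<Sum>k\<in>{i - 1, i}. lower_bidiagonal \<alpha> i k * upper_bidiagonal \<alpha> k j)"
    unfolding inf_mat_mult_def by (rule suminf_finite) (auto simp: lower_bidiagonal_def)
  also have "\<dots> = upper_bidiagonal \<alpha> i j
      + (if i = 0 then 0 else \<alpha> (2 * i) * upper_bidiagonal \<alpha> (i - 1) j)"
    by (cases i) (auto simp: lower_bidiagonal_def)
  finally show ?thesis .
qed

lemma shifted_jacobi_eq_bidiagonal_product:
  assumes diag0: "\<alpha> 1 = m 0 + s"
    and diag: "\<And>n. \<alpha> (2 * Suc n) + \<alpha> (2 * Suc n + 1) = m (Suc n) + s"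
    and sub: "\<And>n. \<alpha> (2 * Suc n) * \<alpha> (2 * n + 1) = l (Suc n)"
  shows "shifted (jacobi m l) s = inf_mat_mult (lower_bidiagonal \<alpha>) (upper_bidiagonal \<alpha>)"
proof (intro ext)
  fix i j
  show "shifted (jacobi m l) s i j =
      inf_mat_mult (lower_bidiagonal \<alpha>) (upper_bidiagonal \<alpha>) i j"
  proof (cases i)
    case 0
    then show ?thesis
      using diag0 by (simp add: bidiagonal_product shifted_def jacobi_def upper_bidiagonal_def)
  next
    case (Suc n)
    consider "j = n" | "j = Suc n" | "j = Suc (Suc n)" | "j \<noteq> n" "j \<noteq> Suc n" "j \<noteq> Suc (Suc n)"
      by blast
    then show ?thesis
      using diag[of n] sub[of n] Suc
      by cases (simp_all add: bidiagonal_product shifted_def jacobi_def upper_bidiagonal_def)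
  qed
qed

theorem theorem1p7:
  fixes m l :: "nat \<Rightarrow> real" and J :: inf_mat and b s :: real
  assumes J_def: "J = jacobi m l"
    and l_pos: "\<And>n. n \<ge> 1 \<Longrightarrow> l n > 0"
    and J_bounded: "bounded_operator J"
    and b_def: "b = neg_eigenvalue_bound J"
    and s_ge: "s \<ge> b"
  shows "oscillatory (shifted J s) \<and>
    (\<exists>\<alpha> :: nat \<Rightarrow> real. (\<forall>n\<ge>1. \<alpha> n > 0) \<and>
       shifted J s = inf_mat_mult (lower_bidiagonal \<alpha>) (upper_bidiagonal \<alpha>))"
proof -
  let ?A = "shifted J s"
  obtain C where C: "\<And>i j. \<bar>jacobi m l i j\<bar> \<le> C"
    using bounded_operator_entry[OF J_bounded] J_def by auto
  have m: "\<bar>m n\<bar> \<le> C" and l: "\<bar>l (Suc n)\<bar> \<le> C" for n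
    using C[of n n] C[of "Suc n" n] by (simp_all add: jacobi_def)
  define D where "D = leading_minor ?A"
  have D_pos: "D n > 0" for n
    unfolding D_def J_def
    using leading_minor_shifted_jacobi_pos[of l m C s n] l_pos m l s_ge b_def J_def by auto
  have D_0: "D 0 = 1" and D_1: "D (Suc 0) = m 0 + s"
    and D_rec: "\<And>n. D (Suc (Suc n)) = (m (Suc n) + s) * D (Suc n) - l (Suc n) * D n"
    unfolding D_def J_def
    by (simp_all only: minor_0 leading_minor_shifted_jacobi_1 leading_minor_shifted_jacobi_rec)
  have entries: "?A n n = m n + s" "?A n (Suc n) = 1" "?A (Suc n) n = l (Suc n)" for n
    by (simp_all add: J_def shifted_def jacobi_def)

  \<comment> \<open>Gaussian elimination without pivoting: the pivots are quotients of leading minors. The value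
    \<open>w 0 = 0\<close> says that no elimination step precedes the first pivot.\<close>
  define u where "u n = D (Suc n) / D n" for n
  define w where "w n = (if n = 0 then 0 else l n * D (n - 1) / D n)" for n
  have u_pos: "u n > 0" for n
    using D_pos by (simp add: u_def)
  have w_pos: "w (Suc n) > 0" for n
    using D_pos l_pos by (simp add: w_def)
  have w_nonneg: "w n \<ge> 0" for n
    using w_pos[of "n - 1"] by (cases n) (auto simp: w_def)
  have u_0: "u 0 = m 0 + s"
    by (simp add: u_def D_0 D_1)
  have diag: "w (Suc n) + u (Suc n) = m (Suc n) + s" for n
    using D_pos[of "Suc n"] by (simp add: u_def w_def D_rec field_simps)
  have off_diag: "w (Suc n) * u n = l (Suc n)" for n
    using D_pos[of n] D_pos[of "Suc n"] by (simp add: u_def w_def)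

  have "oscillatory_mat (truncation ?A N)" for N
    unfolding oscillatory_mat_def
  proof (intro conjI)
    show "square_mat (truncation ?A N)"
      by (simp add: truncation_def)
    show "totally_nonnegative (truncation ?A N)"
    proof (rule totally_nonnegative_truncation)
      show "tridiagonal ?A"
        unfolding J_def by (rule tridiagonal_shifted_jacobi)
      show "?A n n = w n + u n" for n
        using u_0 diag by (cases n) (simp_all add: entries w_def)
    qed (use u_pos w_nonneg off_diag l_pos in \<open>simp_all add: entries less_imp_le\<close>)
    show "irreducible_mat (truncation ?A N)"
      by (rule irreducible_truncation) (use l_pos in \<open>simp_all add: entries less_imp_neq[symmetric]\<close>)
    show "invertible_mat (truncation ?A N)"
    proof (rule invertible_mat_if_det_nonzero)
      show "truncation ?A N \<in> carrier_mat (Suc N) (Suc N)"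
        by (simp add: truncation_def)
      show "det (truncation ?A N) \<noteq> 0"
        using D_pos[of "Suc N"] by (simp add: det_truncation D_def)
    qed
  qed
  then have "oscillatory ?A"
    by (simp add: oscillatory_def)
  moreover have "\<exists>\<alpha>. (\<forall>n\<ge>1. \<alpha> n > 0) \<and>
      ?A = inf_mat_mult (lower_bidiagonal \<alpha>) (upper_bidiagonal \<alpha>)"
  proof -
    define \<alpha> where "\<alpha> n = (if even n then w (n div 2) else u (n div 2))" for n :: nat
    have \<alpha>: "\<alpha> (2 * n) = w n" "\<alpha> (2 * n + 1) = u n" for n
      by (simp_all add: \<alpha>_def)
    have "\<alpha> n > 0" if "n \<ge> 1" for n
    proof (cases "even n")
      case True
      with that obtain k where "n div 2 = Suc k"
        by (cases "n div 2") auto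
      with True show ?thesis using w_pos by (simp add: \<alpha>_def)
    qed (use u_pos in \<open>simp add: \<alpha>_def\<close>)
    moreover have "?A = inf_mat_mult (lower_bidiagonal \<alpha>) (upper_bidiagonal \<alpha>)"
      unfolding J_def
    proof (rule shifted_jacobi_eq_bidiagonal_product)
      show "\<alpha> 1 = m 0 + s"
        using \<alpha>(2)[of 0] u_0 by simp
    qed (simp_all only: \<alpha> diag off_diag)
    ultimately show ?thesis by blast
  qed
  ultimately show ?thesis by blast
qed

end
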